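(* Let $Q$ be a prime power, let $h(x)\in\mathbb{F}_Q[x]$, let $q=Q^m$ where $m$ is a positive integer, and let $r$ be a positive integer. Then $x^r h\bigl(x^{(q-1)/(Q-1)}\bigr)$ permutes $\mathbb{F}_q$ if and only if both of the following hold: (1) $\gcd\bigl(r,(q-1)/(Q-1)\bigr)=1$; and (2) $g(x):=x^r h(x)^m$ permutes $\mathbb{F}_Q$.
   Context: For a prime power $Q$, $\mathbb{F}_Q$ denotes the finite field with $Q$ elements, and it is regarded as a subfield of $\mathbb{F}_{Q^m}$. A polynomial $f(x)$ permutes a finite field $\mathbb{F}$ if the function $\alpha\mapsto f(\alpha)$ is a bijection from $\mathbb{F}$ to itself. *)

theory Defs
  imports
    "HOL-Algebra.Algebraic_Closure_Type"
    "HOL-Computational_Algebra.Polynomial"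
    "HOL-Number_Theory.Prime_Powers"
begin

(* The set F is the carrier of a field that contains the coefficients of f; it need not be
   the whole type, so that a polynomial over a subfield can be asked to permute that subfield. *)
definition permutes_field :: "'a::field poly \<Rightarrow> 'a set \<Rightarrow> bool" where
  "permutes_field f F \<longleftrightarrow> bij_betw (poly f) F F"

end

theory Submission
  imports Defs
begin

text \<open>
  Put \<open>s = (q - 1) / (Q - 1) = 1 + Q + \<dots> + Q ^ (m - 1)\<close>. The norm \<open>N x = x ^ s\<close> maps the large
  field onto the small one and satisfies \<open>N c = c ^ m\<close> on the small one, so \<open>N (f x) = g (N x)\<close>
  for \<open>f x = x ^ r * h (x ^ s)\<close> and \<open>g c = c ^ r * h c ^ m\<close>. Hence \<open>g\<close> is onto if \<open>f\<close> is.
  Conversely, if \<open>g\<close> is injective, then \<open>f x = f y\<close> forces \<open>N x = N y\<close>. A nonzero fibre of \<open>N\<close> is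
  a coset of the \<open>s\<close>-th roots of unity on which \<open>f\<close> is a multiple of \<open>x \<mapsto> x ^ r\<close>, and this power
  map is injective there iff \<open>r\<close> and \<open>s\<close> are coprime.
\<close>

text \<open>These are the roots of \<open>X ^ n - a\<close>, which is nonzero since its coefficient
  at \<open>n > 0\<close> is 1.\<close>

lemma card_power_eq_le:
  fixes a :: "'a::idom"
  assumes "n > 0"
  shows "finite {x. x ^ n = a}" and "card {x. x ^ n = a} \<le> n"
proof -
  define p where "p = Polynomial.monom 1 n - [:a:]"
  have c: "poly.coeff p n = 1"
    using assms by (cases n) (simp_all add: p_def)
  hence "p \<noteq> 0"
    by auto
  moreover have roots: "{x. x ^ n = a} = {x. poly p x = 0}"
    by (simp add: p_def poly_monom)
  moreover have "Polynomial.degree p \<le> n"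
    unfolding p_def by (intro degree_diff_le degree_monom_le) simp
  ultimately show "finite {x. x ^ n = a}" "card {x. x ^ n = a} \<le> n"
    using poly_roots_finite[of p] card_poly_roots_bound[of p] by simp_all
qed

text \<open>Carries closure properties from the record-based \<open>subfield\<close> over to the
  type-class operations used in the rest of the proof.\<close>

lemma subfield_ring_of_type_algebraD:
  fixes F :: "'a::field set"
  assumes "subfield F (ring_of_type_algebra :: 'a ring)"
  shows "0 \<in> F" and "1 \<in> F"
    and "\<And>x y. x \<in> F \<Longrightarrow> y \<in> F \<Longrightarrow> x + y \<in> F"
    and "\<And>x y. x \<in> F \<Longrightarrow> y \<in> F \<Longrightarrow> x * y \<in> F"
proof -
  have "subring F (ring_of_type_algebra :: 'a ring)"
    using assms by (rule subfieldE)
  from subringE[OF this] show "0 \<in> F" and "1 \<in> F"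
    and "\<And>x y. x \<in> F \<Longrightarrow> y \<in> F \<Longrightarrow> x + y \<in> F"
    and "\<And>x y. x \<in> F \<Longrightarrow> y \<in> F \<Longrightarrow> x * y \<in> F"
    by (simp_all add: ring_of_type_algebra_def)
qed

lemma power_closed:
  fixes x :: "'a::monoid_mult"
  assumes "1 \<in> F" and "\<And>x y. x \<in> F \<Longrightarrow> y \<in> F \<Longrightarrow> x * y \<in> F" and "x \<in> F"
  shows "x ^ n \<in> F"
  using assms by (induction n) auto

lemma poly_closed:
  fixes p :: "'a::comm_semiring_1 poly"
  assumes "0 \<in> F" and "\<And>x y. x \<in> F \<Longrightarrow> y \<in> F \<Longrightarrow> x + y \<in> F"
    and "\<And>x y. x \<in> F \<Longrightarrow> y \<in> F \<Longrightarrow> x * y \<in> F"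
    and "\<forall>i. poly.coeff p i \<in> F" and "x \<in> F"
  shows "poly p x \<in> F"
  using assms(4)
proof (induction p)
  case 0
  then show ?case using assms(1) by simp
next
  case (pCons a p)
  have "a \<in> F"
    using pCons.prems[rule_format, of 0] by simp
  moreover have "\<forall>i. poly.coeff p i \<in> F"
    using pCons.prems by (metis coeff_pCons_Suc)
  ultimately show ?case
    using pCons.IH assms(2,3,5) by simp
qed

text \<open>Multiplication by \<open>x\<close> permutes the nonzero elements of \<open>F\<close>, so
  their product absorbs the factor \<open>x ^ (card F - 1)\<close>. Stated for a set so that it
  covers both the small and the large field.\<close>

lemma power_card_minus_one_eq_one:
  fixes F :: "'a::field set"
  assumes "finite F" and "0 \<in> F" and "\<And>x y. x \<in> F \<Longrightarrow> y \<in> F \<Longrightarrow> x * y \<in> F"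
    and "x \<in> F" and "x \<noteq> 0"
  shows "x ^ (card F - 1) = 1"
proof -
  let ?U = "F - {0}"
  have inj: "inj_on ((*) x) ?U"
    using \<open>x \<noteq> 0\<close> by (auto simp: inj_on_def)
  have "(*) x ` ?U = ?U"
    using assms inj by (intro endo_inj_surj) auto
  hence "\<Prod>?U = (\<Prod>y\<in>?U. x * y)"
    using prod.reindex[OF inj, of "\<lambda>y. y"] by simp
  also have "\<dots> = x ^ (card F - 1) * \<Prod>?U"
    using assms(1,2) by (simp add: prod.distrib)
  finally show ?thesis
    using \<open>finite F\<close> by simp
qed

text \<open>The nonzero elements of \<open>F\<close> already exhaust the possible number of roots.
  Membership in \<open>F\<close> thus becomes an equation.\<close>

lemma power_card_minus_one_roots:
  fixes F :: "'a::field set"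
  assumes "finite F" and "0 \<in> F" and "\<And>x y. x \<in> F \<Longrightarrow> y \<in> F \<Longrightarrow> x * y \<in> F"
    and "card F > 1"
  shows "{x. x ^ (card F - 1) = 1} = F - {0}"
proof (rule card_seteq[symmetric])
  show "finite {x::'a. x ^ (card F - 1) = 1}" "card {x::'a. x ^ (card F - 1) = 1} \<le> card (F - {0})"
    using card_power_eq_le[of "card F - 1" "1::'a"] assms by simp_all
  show "F - {0} \<subseteq> {x. x ^ (card F - 1) = 1}"
    using power_card_minus_one_eq_one[OF assms(1-3)] by auto
qed

text \<open>Each fibre of the power map has at most \<open>s\<close> elements, so the image has at
  least \<open>card U / s\<close> elements, enough to fill \<open>V\<close>.\<close>

lemma image_power_eq:
  fixes V :: "'a::idom set"
  assumes "finite V" and "finite U" and "s > 0" and "card V * s \<le> card U"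
    and "(\<lambda>x. x ^ s) ` U \<subseteq> V"
  shows "(\<lambda>x. x ^ s) ` U = V"
proof (rule card_seteq[OF \<open>finite V\<close> assms(5)])
  let ?I = "(\<lambda>x. x ^ s) ` U"
  have "card U = card (\<Union>a\<in>?I. {x \<in> U. x ^ s = a})"
    by (rule arg_cong[of _ _ card]) auto
  also have "\<dots> \<le> (\<Sum>a\<in>?I. card {x \<in> U. x ^ s = a})"
    using \<open>finite U\<close> by (intro card_UN_le) simp
  also have "\<dots> \<le> (\<Sum>a\<in>?I. s)"
  proof (rule sum_mono)
    fix a
    have "card {x \<in> U. x ^ s = a} \<le> card {x. x ^ s = a}"
      using card_power_eq_le(1)[OF \<open>s > 0\<close>] by (intro card_mono) auto
    also have "\<dots> \<le> s"
      using card_power_eq_le(2)[OF \<open>s > 0\<close>] .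
    finally show "card {x \<in> U. x ^ s = a} \<le> s" .
  qed
  finally have "card U \<le> card ?I * s"
    by simp
  with assms(4) have "card V * s \<le> card ?I * s"
    by (rule order_trans)
  thus "card V \<le> card ?I"
    using \<open>s > 0\<close> by simp
qed

text \<open>With \<open>q - 1 = d * k\<close>, the equation \<open>x ^ k = 1\<close> has at most
  \<open>k < q - 1\<close> solutions. Any other nonzero \<open>x\<close> yields the root
  \<open>x ^ k\<close>.\<close>

lemma ex_nontrivial_root_of_unity:
  fixes d :: nat
  assumes "d dvd card (UNIV :: 'a::{field,finite} set) - 1" and "d > 1"
  obtains z :: "'a::{field,finite}" where "z ^ d = 1" and "z \<noteq> 1"
proof -
  let ?q = "card (UNIV :: 'a set)"
  have q: "?q > 1"
    using card_mono[of UNIV "{0, 1 :: 'a}"] by simp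
  obtain k where k: "?q - 1 = d * k"
    using assms(1) by blast
  have "k > 0" "k < ?q - 1"
    using k q assms(2) by (cases "k = 0"; simp)+
  have "\<not> UNIV - {0} \<subseteq> {x::'a. x ^ k = 1}"
  proof
    assume "UNIV - {0} \<subseteq> {x::'a. x ^ k = 1}"
    hence "?q - 1 \<le> card {x::'a. x ^ k = 1}"
      using card_mono[of "{x::'a. x ^ k = 1}" "UNIV - {0}"] by simp
    with card_power_eq_le(2)[OF \<open>k > 0\<close>, of "1::'a"] \<open>k < ?q - 1\<close> show False
      by simp
  qed
  then obtain x :: 'a where "x \<noteq> 0" "x ^ k \<noteq> 1"
    by blast
  moreover have "(x ^ k) ^ d = 1"
    using power_card_minus_one_eq_one[of UNIV x] \<open>x \<noteq> 0\<close> k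
    by (simp add: power_mult[symmetric] mult.commute)
  ultimately show thesis
    using that by blast
qed

text \<open>The Bezout identity is taken with natural coefficients, so no inverses are
  needed.\<close>

lemma power_eq_one_coprime:
  fixes z :: "'a::monoid_mult"
  assumes "z ^ a = 1" and "z ^ b = 1" and "coprime a b" and "a > 0"
  shows "z = 1"
proof -
  obtain x y where "a * x = b * y + 1"
    using bezout_nat[of a b] assms(3,4) by auto
  hence "z ^ (a * x) = z ^ (b * y) * z"
    by (simp add: power_commutes)
  thus ?thesis
    using assms(1,2) by (simp add: power_mult)
qed

theorem corollary1p2:
  fixes Q q m r :: nat
    and FQ :: "'a::{field,finite} set"
    and h :: "'a poly"
  assumes "primepow Q"
    and "m > 0"
    and "q = Q ^ m"
    and "r > 0"
    and "card (UNIV :: 'a set) = q"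
    and "subfield FQ (ring_of_type_algebra :: 'a ring)"
    and "card FQ = Q"
    and "\<forall>i. poly.coeff h i \<in> FQ"
  shows "permutes_field
           (Polynomial.monom 1 r * pcompose h (Polynomial.monom 1 ((q - 1) div (Q - 1))))
           (UNIV :: 'a set)
         \<longleftrightarrow> gcd r ((q - 1) div (Q - 1)) = 1
           \<and> permutes_field (Polynomial.monom 1 r * h ^ m) FQ"
proof -
  note F = subfield_ring_of_type_algebraD[OF assms(6)]
  define s where "s = (q - 1) div (Q - 1)"
  define f where "f = (\<lambda>x::'a. x ^ r * poly h (x ^ s))"
  define g where "g = (\<lambda>x::'a. x ^ r * poly h x ^ m)"
  have f_eq: "poly (Polynomial.monom 1 r * pcompose h (Polynomial.monom 1 s)) = f"
    by (simp add: f_def fun_eq_iff poly_pcompose poly_monom)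
  have g_eq: "poly (Polynomial.monom 1 r * h ^ m) = g"
    by (simp add: g_def fun_eq_iff poly_monom)
  have Q: "Q > 1"
    using primepow_gt_Suc_0[OF assms(1)] by simp
  have q: "q > 1"
    using one_less_power[OF Q assms(2)] assms(3) by simp
  have geo: "q - 1 = (Q - 1) * (\<Sum>i<m. Q ^ i)"
  proof -
    \<comment> \<open>The geometric sum formula is applied over the integers to avoid truncated
      subtraction.\<close>
    have "int (q - 1) = int ((Q - 1) * (\<Sum>i<m. Q ^ i))"
      using Q q power_diff_1_eq[of "int Q" m] by (simp add: of_nat_diff assms(3))
    thus ?thesis
      by linarith
  qed
  have s_sum: "s = (\<Sum>i<m. Q ^ i)"
    using geo Q by (simp add: s_def)
  have qs: "q - 1 = (Q - 1) * s"
    using geo s_sum by simp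
  have "s > 0"
    using qs q by (cases "s = 0") auto
  have FQ_iff: "x \<in> FQ \<longleftrightarrow> x = 0 \<or> x ^ (Q - 1) = 1" for x
    using power_card_minus_one_roots[of FQ] F Q assms(7) by auto
  have powQ: "c ^ Q = c" if "c \<in> FQ" for c
  proof -
    have "c ^ Q = c * c ^ (Q - 1)"
      using Q by (simp flip: power_Suc)
    thus ?thesis
      using that FQ_iff[of c] by auto
  qed
  \<comment> \<open>Each of the \<open>m\<close> factors \<open>c ^ (Q ^ i)\<close> of
    \<open>c ^ s\<close> equals \<open>c\<close>, so the norm of \<open>c\<close> is
    \<open>c ^ m\<close>.\<close>
  have "c ^ (Q ^ i) = c" if "c \<in> FQ" for c i
    using powQ[OF that] by (induction i) (simp_all add: power_mult)
  hence norm_FQ: "c ^ s = c ^ m" if "c \<in> FQ" for c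
    using that by (simp add: s_sum power_sum)
  have norm_in: "x ^ s \<in> FQ" for x :: 'a
  proof (cases "x = 0")
    case False
    \<comment> \<open>The exponent is \<open>q - 1\<close>, so \<open>x ^ s\<close> satisfies the
      equation that characterises \<open>FQ\<close>.\<close>
    hence "x ^ (s * (Q - 1)) = 1"
      using power_card_minus_one_eq_one[of "UNIV :: 'a set" x] assms(5) qs
      by (simp add: mult.commute)
    thus ?thesis
      by (simp add: FQ_iff power_mult)
  qed (use \<open>s > 0\<close> F(1) in \<open>simp add: zero_power\<close>)
  \<comment> \<open>The counting bound holds with equality:
    \<open>(Q - 1) * s = q - 1\<close>.\<close>
  have "(\<lambda>x. x ^ s) ` (UNIV - {0}) = FQ - {0}"
    using norm_in \<open>s > 0\<close> F(1) qs by (intro image_power_eq) (auto simp: assms(5,7))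
  hence norm_surj: "\<exists>x. c = x ^ s" if "c \<in> FQ" for c
    using that \<open>s > 0\<close> by (cases "c = 0") (auto intro: exI[of _ 0])
  have h_in: "poly h c \<in> FQ" if "c \<in> FQ" for c
    using poly_closed[OF F(1,3,4) assms(8) that] .
  \<comment> \<open>The exponent \<open>m\<close> in \<open>g\<close> arises here, as the norm of
    \<open>poly h (x ^ s)\<close>, an element of \<open>FQ\<close>.\<close>
  have norm_f: "f x ^ s = g (x ^ s)" for x
    using norm_FQ[OF h_in[OF norm_in]]
    by (simp add: f_def g_def power_mult_distrib power_mult[symmetric] mult.commute)
  have g_in: "g c \<in> FQ" if "c \<in> FQ" for c
    unfolding g_def using that h_in F by (intro F(4) power_closed) auto
  have f_perm: "bij_betw f UNIV UNIV \<longleftrightarrow> inj f"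
    by (auto simp: bij_betw_def finite_UNIV_inj_surj)
  have "inj f \<longleftrightarrow> gcd r s = 1 \<and> bij_betw g FQ FQ"
  proof (intro iffI conjI)
    assume "inj f"
    show "gcd r s = 1"
    proof (rule ccontr)
      assume "gcd r s \<noteq> 1"
      moreover have "gcd r s > 0"
        using \<open>r > 0\<close> by simp
      ultimately have "gcd r s > 1"
        by linarith
      moreover have "gcd r s dvd card (UNIV :: 'a set) - 1"
        unfolding assms(5) qs by (intro dvd_mult gcd_dvd2)
      ultimately obtain z :: 'a where z: "z ^ gcd r s = 1" "z \<noteq> 1"
        using ex_nontrivial_root_of_unity by blast
      \<comment> \<open>Applied to \<open>r\<close> and \<open>s\<close>, this makes both
        \<open>f z\<close> and \<open>f 1\<close> equal to \<open>poly h 1\<close>.\<close>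
      have "z ^ n = 1" if "gcd r s dvd n" for n
        using that z(1) by (auto simp: power_mult elim!: dvdE)
      hence "f z = f 1"
        by (simp add: f_def)
      with \<open>inj f\<close> z(2) show False
        by (auto dest: injD)
    qed
    have "surj f"
      using \<open>inj f\<close> by (simp add: finite_UNIV_inj_surj)
    have "FQ \<subseteq> g ` FQ"
    proof
      fix c assume "c \<in> FQ"
      then obtain y where "c = y ^ s"
        using norm_surj by blast
      moreover obtain x where "y = f x"
        using \<open>surj f\<close> by (auto elim: surjE)
      ultimately show "c \<in> g ` FQ"
        using norm_f norm_in by auto
    qed
    hence "g ` FQ = FQ"
      using g_in by auto
    thus "bij_betw g FQ FQ"
      using finite_surj_inj[of FQ g] by (simp add: bij_betw_def)
  next
    assume "gcd r s = 1 \<and> bij_betw g FQ FQ"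
    hence "coprime r s" and inj: "inj_on g FQ"
      by (auto simp: coprime_iff_gcd_eq_1 bij_betw_def)
    show "inj f"
    proof (rule injI)
      fix x y
      assume eq: "f x = f y"
      hence "g (x ^ s) = g (y ^ s)"
        by (metis norm_f)
      hence N: "x ^ s = y ^ s"
        using inj norm_in by (auto dest: inj_onD)
      show "x = y"
      proof (cases "y = 0")
        case True
        with N \<open>s > 0\<close> show ?thesis by (simp add: zero_power)
      next
        case False
        \<comment> \<open>Otherwise \<open>g\<close> would vanish both at 0 and at the nonzero norm
          \<open>y ^ s\<close>, against injectivity. This allows cancelling the common
          \<open>h\<close> factor in \<open>f x = f y\<close>.\<close>
        have "poly h (y ^ s) \<noteq> 0"
        proof
          assume "poly h (y ^ s) = 0"
          hence "g (y ^ s) = g 0"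
            using \<open>m > 0\<close> \<open>r > 0\<close> by (simp add: g_def zero_power)
          hence "y ^ s = 0"
            using inj norm_in F(1) by (auto dest: inj_onD)
          with False show False by simp
        qed
        hence "x ^ r = y ^ r"
          using eq N by (simp add: f_def)
        hence "(x / y) ^ r = 1" "(x / y) ^ s = 1"
          using N False by (simp_all add: power_divide)
        hence "x / y = 1"
          using \<open>coprime r s\<close> \<open>r > 0\<close> by (rule power_eq_one_coprime)
        with False show ?thesis by simp
      qed
    qed
  qed
  thus ?thesis
    unfolding permutes_field_def s_def[symmetric] f_eq g_eq f_perm .
qed

end
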